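(* Let $\Delta$ be an $a$-antipodal distance-regular graph of diameter $3$ which is $(v,k,\lambda)$-edge-regular, such that $a$ is a proper divisor of $\lambda+2$, and put $t = (\lambda+2)/a$. Let $\mathsf A_1 = A(\Delta)$, and for $i\in\{1,2,3\}$ let $\mathsf A_i$ be the $v\times v$ matrix whose $(x,y)$ entry is $1$ if $d(x,y)=i$ and $0$ otherwise; suppose that $\mathcal W(\Delta) = \langle I, \mathsf A_1, \mathsf A_2, \mathsf A_3\rangle$. Let $\mathfrak K(\Delta)$ be the graph with adjacency matrix $I_t\otimes(\mathsf A_1+\mathsf A_3) + (J_t-I_t)\otimes(I+\mathsf A_3)$. Then \[ \mathcal W(\mathfrak K(\Delta)) = \left\langle I, I_t\otimes \mathsf A_1, I_t\otimes\mathsf A_2, I_t\otimes \mathsf A_3, (J_t-I_t)\otimes(I+\mathsf A_3), (J_t-I_t)\otimes(\mathsf A_1+\mathsf A_2)\right\rangle. \]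
   Context: $I_n$, $J_n$ denote the identity and all-ones $n\times n$ matrices; $\otimes$ is the Kronecker product; $d(x,y)$ is graph distance. A connected graph of diameter $D$ is $a$-antipodal if "being at distance $0$ or $D$" is an equivalence relation whose classes have size $a$. A graph is distance-regular if for vertices $x,y$ with $d(x,y)=k$ the number of vertices at distance $i$ from $x$ and $j$ from $y$ depends only on $i,j,k$. A graph is $(v,k,\lambda)$-edge-regular if it has $v$ vertices, is $k$-regular and every edge lies in exactly $\lambda$ triangles. A coherent algebra is a subalgebra $\mathcal A$ of complex square matrices (indexed by a finite set) containing $I$ and $J$, closed under transpose, matrix multiplication and entrywise (Hadamard) multiplication. The coherent closure $\mathcal W(\Gamma)$ of a graph $\Gamma$ is the smallest coherent algebra containing its adjacency matrix $A(\Gamma)$; $\langle\cdot\rangle$ denotes linear span. *)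

theory Defs
  imports "HOL-Analysis.Analysis"
begin

text \<open>Graphs are given by their adjacency relation on a finite vertex type; matrices indexed by
  a finite type \<open>'n\<close> have type \<open>complex^'n^'n\<close>.\<close>

definition simple_graph :: "('n \<Rightarrow> 'n \<Rightarrow> bool) \<Rightarrow> bool" where
  "simple_graph E \<longleftrightarrow> symp E \<and> irreflp E"

definition connected_graph :: "('n \<Rightarrow> 'n \<Rightarrow> bool) \<Rightarrow> bool" where
  "connected_graph E \<longleftrightarrow> (\<forall>x y. \<exists>m. (E ^^ m) x y)"

text \<open>The distance is only meaningful when \<open>y\<close> is reachable from \<open>x\<close>; the notions below that
  depend on it are used for connected graphs only.\<close>

definition graph_dist :: "('n \<Rightarrow> 'n \<Rightarrow> bool) \<Rightarrow> 'n \<Rightarrow> 'n \<Rightarrow> nat" where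
  "graph_dist E x y = (LEAST m. (E ^^ m) x y)"

definition graph_diameter :: "('n::finite \<Rightarrow> 'n \<Rightarrow> bool) \<Rightarrow> nat" where
  "graph_diameter E = Max {graph_dist E x y | x y. True}"

definition distance_regular :: "('n::finite \<Rightarrow> 'n \<Rightarrow> bool) \<Rightarrow> bool" where
  "distance_regular E \<longleftrightarrow> connected_graph E \<and>
     (\<forall>i j k. \<exists>p. \<forall>x y. graph_dist E x y = k \<longrightarrow>
        card {z. graph_dist E x z = i \<and> graph_dist E y z = j} = p)"

definition antipodal_rel :: "('n::finite \<Rightarrow> 'n \<Rightarrow> bool) \<Rightarrow> ('n \<times> 'n) set" where
  "antipodal_rel E = {(x, y). graph_dist E x y = 0 \<or> graph_dist E x y = graph_diameter E}"

definition antipodal :: "nat \<Rightarrow> ('n::finite \<Rightarrow> 'n \<Rightarrow> bool) \<Rightarrow> bool" where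
  "antipodal a E \<longleftrightarrow> connected_graph E \<and> equiv UNIV (antipodal_rel E) \<and>
     (\<forall>C \<in> UNIV // antipodal_rel E. card C = a)"

text \<open>The triangles containing an edge correspond to the common neighbours of its ends.\<close>

definition edge_regular :: "nat \<Rightarrow> nat \<Rightarrow> nat \<Rightarrow> ('n::finite \<Rightarrow> 'n \<Rightarrow> bool) \<Rightarrow> bool" where
  "edge_regular v k l E \<longleftrightarrow> CARD('n) = v \<and> (\<forall>x. card {y. E x y} = k) \<and>
     (\<forall>x y. E x y \<longrightarrow> card {z. E x z \<and> E y z} = l)"

definition all_ones :: "complex^'n^'n" where
  "all_ones = (\<chi> i j. 1)"

definition hadamard :: "complex^'n^'n \<Rightarrow> complex^'n^'n \<Rightarrow> complex^'n^'n" where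
  "hadamard A B = (\<chi> i j. A $ i $ j * B $ i $ j)"

definition kronecker ::
  "complex^'t^'t \<Rightarrow> complex^'n^'n \<Rightarrow> complex^('t::finite \<times> 'n::finite)^('t \<times> 'n)" where
  "kronecker A B = (\<chi> p q. A $ fst p $ fst q * B $ snd p $ snd q)"

text \<open>The library's \<open>span\<close> on \<open>complex^'n^'n\<close> is the real span, so the complex scalar
  multiplication of matrices is interpreted as a vector space separately.\<close>

definition cmat_scale :: "complex \<Rightarrow> complex^'n^'n \<Rightarrow> complex^'n^'n" where
  "cmat_scale c A = (\<chi> i j. c * A $ i $ j)"

interpretation cmat: vector_space "cmat_scale :: complex \<Rightarrow> complex^'n^'n \<Rightarrow> complex^'n^'n"
  by unfold_locales (simp_all add: cmat_scale_def vec_eq_iff algebra_simps)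

definition coherent_algebra :: "(complex^'n::finite^'n) set \<Rightarrow> bool" where
  "coherent_algebra \<A> \<longleftrightarrow> cmat.subspace \<A> \<and> mat 1 \<in> \<A> \<and> all_ones \<in> \<A> \<and>
     (\<forall>A \<in> \<A>. transpose A \<in> \<A>) \<and>
     (\<forall>A \<in> \<A>. \<forall>B \<in> \<A>. A ** B \<in> \<A>) \<and>
     (\<forall>A \<in> \<A>. \<forall>B \<in> \<A>. hadamard A B \<in> \<A>)"

definition adjacency_matrix :: "('n \<Rightarrow> 'n \<Rightarrow> bool) \<Rightarrow> complex^'n^'n" where
  "adjacency_matrix E = (\<chi> x y. if E x y then 1 else 0)"

definition distance_matrix :: "('n \<Rightarrow> 'n \<Rightarrow> bool) \<Rightarrow> nat \<Rightarrow> complex^'n^'n" where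
  "distance_matrix E i = (\<chi> x y. if graph_dist E x y = i then 1 else 0)"

definition coherent_closure :: "('n::finite \<Rightarrow> 'n \<Rightarrow> bool) \<Rightarrow> (complex^'n^'n) set" where
  "coherent_closure E = \<Inter> {\<A>. coherent_algebra \<A> \<and> adjacency_matrix E \<in> \<A>}"

lemma coherent_closure_is_least:
  shows "coherent_algebra (coherent_closure E)"
    and "adjacency_matrix E \<in> coherent_closure E"
    and "\<lbrakk>coherent_algebra \<A>; adjacency_matrix E \<in> \<A>\<rbrakk> \<Longrightarrow> coherent_closure E \<subseteq> \<A>"
  by (auto simp: coherent_closure_def coherent_algebra_def cmat.subspace_def)

definition K_matrix :: "('n::finite \<Rightarrow> 'n \<Rightarrow> bool) \<Rightarrow> complex^('t::finite \<times> 'n)^('t \<times> 'n)" where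
  "K_matrix E = kronecker (mat 1) (distance_matrix E 1 + distance_matrix E 3)
     + kronecker (all_ones - mat 1) (mat 1 + distance_matrix E 3)"

text \<open>The number of copies \<open>t\<close> is the cardinality of the type \<open>'t\<close>. That this relation is a
  simple graph with adjacency matrix \<open>K_matrix E\<close> is shown below.\<close>

definition K_graph :: "('n::finite \<Rightarrow> 'n \<Rightarrow> bool) \<Rightarrow> 't::finite \<times> 'n \<Rightarrow> 't \<times> 'n \<Rightarrow> bool" where
  "K_graph E p q \<longleftrightarrow> K_matrix E $ p $ q = 1"

lemma graph_dist_self [simp]: "graph_dist E x x = 0"
  unfolding graph_dist_def by (rule Least_equality) auto

lemma graph_dist_sym:
  assumes "symp E"
  shows "graph_dist E x y = graph_dist E y x"
proof -
  have "(E ^^ m) y x" if "(E ^^ m) x y" for m x y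
    using that
  proof (induction m arbitrary: x)
    case (Suc m)
    then obtain z where z: "E x z" "(E ^^ m) z y"
      by (meson relpowp_Suc_D2)
    then show ?case
      using Suc.IH assms by (meson relpowp_Suc_I sympD)
  qed auto
  then have "(E ^^ m) x y \<longleftrightarrow> (E ^^ m) y x" for m
    by blast
  then show ?thesis
    by (simp add: graph_dist_def)
qed

lemma distance_matrix_1:
  fixes E :: "'n::finite \<Rightarrow> 'n \<Rightarrow> bool"
  assumes "connected_graph E" "simple_graph E"
  shows "distance_matrix E 1 = adjacency_matrix E"
proof -
  have "graph_dist E x y = 1 \<longleftrightarrow> E x y" for x y
  proof
    assume d: "graph_dist E x y = 1"
    obtain m where "(E ^^ m) x y"
      using assms(1) by (auto simp: connected_graph_def)
    then have "(E ^^ graph_dist E x y) x y"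
      unfolding graph_dist_def by (rule LeastI)
    then show "E x y"
      unfolding d by (auto simp del: relpowp.simps simp: relpowp_1)
  next
    assume e: "E x y"
    then have "x \<noteq> y"
      using assms(2) by (auto simp: simple_graph_def irreflp_def)
    then have "1 \<le> m" if "(E ^^ m) x y" for m
      using that by (cases m) auto
    then show "graph_dist E x y = 1"
      unfolding graph_dist_def using e by (intro Least_equality) (auto simp: relpowp_1)
  qed
  then show ?thesis
    by (simp add: distance_matrix_def adjacency_matrix_def)
qed

lemma adjacency_matrix_K_graph: "adjacency_matrix (K_graph E) = K_matrix E"
  by (auto simp: adjacency_matrix_def K_graph_def K_matrix_def kronecker_def distance_matrix_def
      all_ones_def mat_def vec_eq_iff)

lemma simple_graph_K_graph:
  assumes "simple_graph E"
  shows "simple_graph (K_graph E)"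
  using assms graph_dist_sym[of E]
  by (auto simp: simple_graph_def K_graph_def K_matrix_def kronecker_def distance_matrix_def
      all_ones_def mat_def symp_def irreflp_def split: if_splits)

end

theory Submission
  imports Defs
begin

text \<open>Let \<open>J\<close> be the all-ones matrix, \<open>F = I + A\<^sub>3\<close> the matrix of the antipodal relation and \<open>c\<close>
  the number of common neighbours of two vertices at distance \<open>2\<close>. A vertex has exactly one
  neighbour in every antipodal class but its own, so \<open>A\<^sub>1F = FA\<^sub>1 = J - F\<close>; moreover
  \<open>F\<^sup>2 = aF\<close> and \<open>A\<^sub>1\<^sup>2 = kI + \<lambda>A\<^sub>1 + cA\<^sub>2\<close>. The asserted span is also spanned by the Kronecker
  products of \<open>I\<close> with \<open>I, A\<^sub>1, F, J\<close> and of \<open>J\<close> with \<open>F, J\<close>, hence closed under multiplication.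

  Conversely, let \<open>M\<close> be the adjacency matrix of the graph constructed from \<open>\<Delta>\<close>. On pairs of distinct
  nonadjacent vertices the entries of \<open>M\<^sup>2\<close> are \<open>c + 2\<close> on \<open>D = I \<otimes> A\<^sub>2\<close> and \<open>2\<close> elsewhere, which isolates \<open>D\<close>
  since \<open>c > 0\<close>. The Hadamard product of \<open>D\<^sup>2\<close> and \<open>M\<close> is \<open>s(I \<otimes> A\<^sub>1) + u(I \<otimes> A\<^sub>3)\<close> with
  \<open>s - u = \<lambda> + 2 - a \<noteq> 0\<close>, so at least one of \<open>I \<otimes> A\<^sub>1\<close> and \<open>I \<otimes> A\<^sub>3\<close> is obtained; multiplying it by
  \<open>D\<close> and masking with the rest of \<open>M\<close> yields the other.\<close>

section \<open>Entries of 0/1 matrices and Kronecker products\<close>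

lemma adjacency_matrix_nth: "adjacency_matrix R $ x $ y = of_bool (R x y)"
  by (simp add: adjacency_matrix_def)

lemma adjacency_matrix_mult:
  "(adjacency_matrix R ** adjacency_matrix S) $ x $ y = of_nat (card {z. R x z \<and> S z y})"
proof -
  have "(adjacency_matrix R ** adjacency_matrix S) $ x $ y = (\<Sum>z\<in>UNIV. of_bool (R x z \<and> S z y))"
    by (simp add: matrix_matrix_mult_def adjacency_matrix_def of_bool_def if_distrib cong: if_cong)
      (auto intro!: sum.cong)
  then show ?thesis
    by simp
qed

lemma all_ones_all_ones:
  "(all_ones :: complex^'m::finite^'m) ** all_ones = cmat_scale (of_nat CARD('m)) all_ones"
  by (simp add: vec_eq_iff all_ones_def matrix_matrix_mult_def cmat_scale_def)

lemma kronecker_mult: "kronecker A B ** kronecker C D = kronecker (A ** C) (B ** D)"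
  by (simp add: vec_eq_iff kronecker_def matrix_matrix_mult_def sum_product sum.cartesian_product
      mult_ac UNIV_Times_UNIV[symmetric] case_prod_unfold del: UNIV_Times_UNIV)

lemma kronecker_add: "kronecker X (Y + Z) = kronecker X Y + kronecker X Z"
  by (simp add: vec_eq_iff kronecker_def algebra_simps)

lemma kronecker_diff:
  "kronecker X (Y - Z) = kronecker X Y - kronecker X Z"
  "kronecker (Y - Z) X = kronecker Y X - kronecker Z X"
  by (simp_all add: vec_eq_iff kronecker_def algebra_simps)

lemma kronecker_scale:
  "kronecker (cmat_scale c X) Y = cmat_scale c (kronecker X Y)"
  "kronecker X (cmat_scale c Y) = cmat_scale c (kronecker X Y)"
  by (simp_all add: vec_eq_iff kronecker_def cmat_scale_def)

lemma kronecker_one_one: "kronecker (mat 1) (mat 1) = mat 1"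
  by (auto simp: vec_eq_iff kronecker_def mat_def prod_eq_iff)

section \<open>Matrices constant on the colour classes of pairs\<close>

text \<open>The matrices constant on the colour classes of \<open>r\<close>; an algebra only for suitable \<open>r\<close>.\<close>

definition colour_algebra :: "('m::finite \<Rightarrow> 'm \<Rightarrow> nat) \<Rightarrow> (complex^'m^'m) set" where
  "colour_algebra r = {X. \<exists>g. \<forall>p q. X $ p $ q = g (r p q)}"

lemma colour_algebraI: "(\<And>p q. X $ p $ q = g (r p q)) \<Longrightarrow> X \<in> colour_algebra r"
  by (auto simp: colour_algebra_def)

lemma subspace_colour_algebra: "cmat.subspace (colour_algebra r)"
proof (rule cmat.subspaceI)
  show "0 \<in> colour_algebra r"
    by (rule colour_algebraI[where g = "\<lambda>_. 0"]) simp
next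
  fix X Y assume "X \<in> colour_algebra r" "Y \<in> colour_algebra r"
  then obtain g h where "\<forall>p q. X $ p $ q = g (r p q)" "\<forall>p q. Y $ p $ q = h (r p q)"
    by (auto simp: colour_algebra_def)
  then show "X + Y \<in> colour_algebra r"
    by (intro colour_algebraI[where g = "\<lambda>i. g i + h i"]) simp
next
  fix c X assume "X \<in> colour_algebra r"
  then obtain g where "\<forall>p q. X $ p $ q = g (r p q)"
    by (auto simp: colour_algebra_def)
  then show "cmat_scale c X \<in> colour_algebra r"
    by (intro colour_algebraI[where g = "\<lambda>i. c * g i"]) (simp add: cmat_scale_def)
qed

lemma hadamard_colour_algebra:
  assumes "X \<in> colour_algebra r" "Y \<in> colour_algebra r"
  shows "hadamard X Y \<in> colour_algebra r"
proof -
  obtain g h where "\<forall>p q. X $ p $ q = g (r p q)" "\<forall>p q. Y $ p $ q = h (r p q)"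
    using assms by (auto simp: colour_algebra_def)
  then show ?thesis
    by (intro colour_algebraI[where g = "\<lambda>i. g i * h i"]) (simp add: hadamard_def)
qed

lemma transpose_colour_algebra:
  assumes "\<And>p q. r p q = r q p" "X \<in> colour_algebra r"
  shows "transpose X \<in> colour_algebra r"
proof -
  obtain g where "\<forall>p q. X $ p $ q = g (r p q)"
    using assms by (auto simp: colour_algebra_def)
  then show ?thesis
    using assms(1) by (intro colour_algebraI[where g = g]) (simp add: transpose_def)
qed

text \<open>The bound on the colours makes the family of indicator matrices finite. It need not be
  sharp: a colour that is not attained contributes the zero matrix.\<close>

lemma colour_algebra_eq_span:
  assumes "\<And>p q. r p q < N"
  shows "colour_algebra r = cmat.span ((\<lambda>i. adjacency_matrix (\<lambda>p q. r p q = i)) ` {..<N})"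
    (is "_ = cmat.span (?E ` _)")
proof (intro equalityI subsetI)
  fix X assume "X \<in> colour_algebra r"
  then obtain g where g: "\<forall>p q. X $ p $ q = g (r p q)"
    by (auto simp: colour_algebra_def)
  have "X = (\<Sum>i<N. cmat_scale (g i) (?E i))"
    using assms g by (simp add: vec_eq_iff cmat_scale_def adjacency_matrix_def if_distrib cong: if_cong)
  moreover have "\<dots> \<in> cmat.span (?E ` {..<N})"
    by (intro cmat.span_sum cmat.span_scale cmat.span_base imageI)
  ultimately show "X \<in> cmat.span (?E ` {..<N})"
    by simp
next
  fix X assume "X \<in> cmat.span (?E ` {..<N})"
  moreover have "?E i \<in> colour_algebra r" for i
    by (rule colour_algebraI[where g = "\<lambda>j. of_bool (j = i)"]) (simp add: adjacency_matrix_def)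
  then have "?E ` {..<N} \<subseteq> colour_algebra r"
    by blast
  ultimately show "X \<in> colour_algebra r"
    using cmat.span_minimal[OF _ subspace_colour_algebra] by blast
qed

section \<open>Bilinearity and closure of spans under products\<close>

lemma matrix_mult_scale:
  "cmat_scale c X ** Y = cmat_scale c (X ** Y)" "X ** cmat_scale c Y = cmat_scale c (X ** Y)"
  by (simp_all add: vec_eq_iff cmat_scale_def matrix_matrix_mult_def sum_distrib_left mult_ac)

lemma matrix_diff_distrib:
  fixes X Y Z :: "complex^'n::finite^'n"
  shows "(X - Y) ** Z = X ** Z - Y ** Z" "Z ** (X - Y) = Z ** X - Z ** Y"
  by (simp_all add: vec_eq_iff matrix_matrix_mult_def algebra_simps sum_subtractf)

lemma matrix_add_distrib_right:
  fixes X Y Z :: "complex^'n::finite^'n"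
  shows "(X + Y) ** Z = X ** Z + Y ** Z"
  by (simp add: vec_eq_iff matrix_matrix_mult_def algebra_simps sum.distrib)

text \<open>Bilinearity, used one factor at a time: first \<open>Y\<close> runs through the span for
  a fixed generator \<open>X\<close>, then \<open>X\<close> does too.\<close>

lemma span_matrix_mult:
  assumes "\<And>X Y. X \<in> S \<Longrightarrow> Y \<in> S \<Longrightarrow> X ** Y \<in> cmat.span S"
    and "X \<in> cmat.span S" "Y \<in> cmat.span S"
  shows "X ** Y \<in> cmat.span S"
proof -
  have *: "X ** Y \<in> cmat.span S" if "X \<in> S" for X
    using assms(3)
  proof (induction rule: cmat.span_induct_alt)
    case (step c x y)
    then show ?case
      using assms(1) that
      by (auto simp: matrix_add_ldistrib matrix_mult_scale intro: cmat.span_add cmat.span_scale)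
  qed (simp add: cmat.span_zero)
  show ?thesis
    using assms(2)
  proof (induction rule: cmat.span_induct_alt)
    case (step c x y)
    then show ?case
      using *
      by (auto simp: matrix_add_distrib_right matrix_mult_scale intro: cmat.span_add cmat.span_scale)
  qed (simp add: cmat.span_zero)
qed

lemma subspace_scale_cancel:
  assumes "cmat.subspace W" "cmat_scale s X \<in> W" "s \<noteq> 0"
  shows "X \<in> W"
  using cmat.subspace_scale[OF assms(1,2), of "inverse s"] assms(3) by simp

section \<open>Distances in a connected graph\<close>

lemma relpowp_graph_dist:
  assumes "connected_graph E"
  shows "(E ^^ graph_dist E x y) x y"
  using assms unfolding graph_dist_def connected_graph_def by (metis LeastI)

lemma graph_dist_le: "(E ^^ m) x y \<Longrightarrow> graph_dist E x y \<le> m"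
  unfolding graph_dist_def by (rule Least_le)

lemma graph_dist_step:
  assumes "connected_graph E" "E x z"
  shows "graph_dist E x y \<le> Suc (graph_dist E z y)"
  using relpowp_Suc_I2[of E, OF assms(2) relpowp_graph_dist[OF assms(1), of z y]]
  by (rule graph_dist_le)

lemma graph_dist_eq_0_iff:
  assumes "connected_graph E"
  shows "graph_dist E x y = 0 \<longleftrightarrow> x = y"
  using relpowp_graph_dist[OF assms, of x y] by auto

lemma graph_dist_eq_1_iff:
  fixes E :: "'n::finite \<Rightarrow> 'n \<Rightarrow> bool"
  assumes "connected_graph E" "simple_graph E"
  shows "graph_dist E x y = 1 \<longleftrightarrow> E x y"
  using arg_cong[OF distance_matrix_1[OF assms], of "\<lambda>M. M $ x $ y"]
  by (auto simp: distance_matrix_def adjacency_matrix_def split: if_splits)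

section \<open>Combinatorics of antipodal classes in diameter 3\<close>

locale antipodal_drg3 =
  fixes E :: "'n::finite \<Rightarrow> 'n \<Rightarrow> bool" and a v k lam :: nat
  assumes simple: "simple_graph E"
    and diam: "graph_diameter E = 3"
    and antipodal: "antipodal a E"
    and dist_reg: "distance_regular E"
    and edge_reg: "edge_regular v k lam E"
begin

abbreviation d where "d \<equiv> graph_dist E"

definition fibre where "fibre x y \<longleftrightarrow> d x y = 0 \<or> d x y = 3"

lemma conn: "connected_graph E"
  using antipodal by (simp add: antipodal_def)

lemmas d_step = graph_dist_step[OF conn]
lemmas d_0_iff = graph_dist_eq_0_iff[OF conn]
lemmas d_1_iff = graph_dist_eq_1_iff[OF conn simple]

lemma d_sym: "d x y = d y x"
  using simple graph_dist_sym by (metis simple_graph_def)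

lemma E_sym: "E x y \<longleftrightarrow> E y x"
  using simple by (auto simp: simple_graph_def symp_def)

lemma finite_dists: "finite {d x y | x y. True}"
  by (rule finite_subset[of _ "(\<lambda>(x, y). d x y) ` UNIV"]) auto

lemma d_le_3: "d x y \<le> 3"
  using Max_ge[OF finite_dists, of "d x y"] diam unfolding graph_diameter_def by auto

lemma ex_dist_3: "\<exists>x y. d x y = 3"
  using Max_in[OF finite_dists] diam unfolding graph_diameter_def by auto

text \<open>Take the first step of a geodesic between two vertices at distance 3. The configuration
  shows that distance 2 occurs and that certain intersection numbers are nonzero.\<close>

lemma ex_path: "\<exists>x w y. d x y = 3 \<and> E x w \<and> d w y = 2"
proof -
  obtain x y where xy: "d x y = 3"
    using ex_dist_3 by blast
  then have "(E ^^ Suc 2) x y"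
    using relpowp_graph_dist[OF conn, of x y] by (simp add: numeral_3_eq_3 numeral_2_eq_2)
  then obtain w where w: "E x w" "(E ^^ 2) w y"
    by (meson relpowp_Suc_D2)
  then have "d w y = 2"
    using graph_dist_le[OF w(2)] d_step[OF w(1), of y] xy by simp
  then show ?thesis
    using xy w by blast
qed

lemma dist_cases:
  obtains "d x y = 0" "x = y" | "d x y = 1" "E x y" | "d x y = 2" | "d x y = 3"
proof -
  have "d x y \<in> {0, 1, 2, 3}"
    using d_le_3[of x y] by auto
  then show ?thesis
    using that d_0_iff d_1_iff by auto
qed

lemma fibre_sym: "fibre x y \<longleftrightarrow> fibre y x"
  by (simp add: fibre_def d_sym[of x y])

lemma fibre_rel: "(x, y) \<in> antipodal_rel E \<longleftrightarrow> fibre x y"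
  by (simp add: antipodal_rel_def fibre_def diam)

lemma fibre_trans: "fibre x y \<Longrightarrow> fibre y z \<Longrightarrow> fibre x z"
  using antipodal transD[of "antipodal_rel E"]
  unfolding antipodal_def equiv_def fibre_rel[symmetric] by blast

lemma card_fibre: "card {y. fibre x y} = a"
proof -
  have "antipodal_rel E `` {x} \<in> UNIV // antipodal_rel E"
    by (simp add: quotientI)
  then have "card (antipodal_rel E `` {x}) = a"
    using antipodal by (auto simp: antipodal_def)
  moreover have "antipodal_rel E `` {x} = {y. fibre x y}"
    by (auto simp: fibre_rel)
  ultimately show ?thesis by simp
qed

lemma not_fibre_if_E: "E x y \<Longrightarrow> \<not> fibre x y"
  using d_1_iff[of x y] by (simp add: fibre_def)

lemma card_fibre_fibre: "card {z. fibre x z \<and> fibre z y} = (if fibre x y then a else 0)"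
proof (cases "fibre x y")
  case True
  then have "{z. fibre x z \<and> fibre z y} = {z. fibre x z}"
    by (metis fibre_sym fibre_trans)
  then show ?thesis
    using True card_fibre by simp
next
  case False
  then have "{z. fibre x z \<and> fibre z y} = {}"
    using fibre_trans by blast
  then show ?thesis
    using False by simp
qed

text \<open>Distance-regularity makes the count constant. It is positive because a path of length 2
  between two vertices at distance 2 has a middle vertex.\<close>

lemma card_neighbours_2: "\<exists>c > 0. \<forall>x y. d x y = 2 \<longrightarrow> card {z. E x z \<and> E z y} = c"
proof -
  obtain c where "\<forall>x y. d x y = 2 \<longrightarrow> card {z. d x z = 1 \<and> d y z = 1} = c"
    using dist_reg unfolding distance_regular_def by blast
  then have c: "card {z. E x z \<and> E z y} = c" if "d x y = 2" for x y
    using that by (simp only: d_1_iff E_sym[of _ y])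
  obtain x y where xy: "d x y = 2"
    using ex_path by blast
  then have "(E ^^ 2) x y"
    using relpowp_graph_dist[OF conn, of x y] by simp
  then obtain z where "E x z" "E z y"
    by (auto simp: numeral_2_eq_2)
  then have "card {z. E x z \<and> E z y} \<noteq> 0"
    by auto
  then show ?thesis
    using c xy by auto
qed

text \<open>At distance 1 the vertex \<open>y\<close> itself works. At distance 2 the number of
  suitable \<open>z\<close> at distance 3 from \<open>y\<close> is an intersection number, so it
  suffices that it is nonzero for the one pair supplied by \<open>ex_path\<close>.\<close>

lemma ex_neighbour_fibre:
  assumes "\<not> fibre x y"
  shows "\<exists>z. E x z \<and> fibre z y"
proof (cases "d x y = 2")
  case True
  obtain p where p: "\<And>x y. d x y = 2 \<Longrightarrow> card {z. d x z = 1 \<and> d y z = 3} = p"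
    using dist_reg unfolding distance_regular_def by blast
  obtain u w u' where u: "d u u' = 3" "E u w" "d w u' = 2"
    using ex_path by blast
  then have "u \<in> {z. d w z = 1 \<and> d u' z = 3}"
    using d_1_iff d_sym E_sym by auto
  then have "p \<noteq> 0"
    using p[OF u(3)] by (metis card_eq_0_iff empty_iff finite)
  then have "{z. d x z = 1 \<and> d y z = 3} \<noteq> {}"
    using p[OF True] by (metis card.empty)
  then show ?thesis
    unfolding fibre_def d_1_iff d_sym[of y] by blast
next
  case False
  then have "E x y"
    using assms by (cases x y rule: dist_cases) (auto simp: fibre_def)
  then show ?thesis
    by (auto simp: fibre_def)
qed

text \<open>Two neighbours of \<open>x\<close> are at distance at most 2, so if they share an
  antipodal class, where only distances 0 and 3 occur, they coincide. A neighbour of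
  \<open>x\<close> never lies in the class of \<open>x\<close>.\<close>

lemma card_neighbour_fibre: "card {z. E x z \<and> fibre z y} = (if fibre x y then 0 else 1)"
proof (cases "fibre x y")
  case True
  then have "{z. E x z \<and> fibre z y} = {}"
    using not_fibre_if_E fibre_sym fibre_trans by blast
  then show ?thesis
    using True by simp
next
  case False
  then obtain z where z: "E x z" "fibre z y"
    using ex_neighbour_fibre by blast
  have "z' = z" if "E x z'" "fibre z' y" for z'
  proof -
    have "fibre z' z"
      using that z fibre_sym fibre_trans by blast
    moreover have "d z' z \<le> 2"
      using d_step[of z' x z] d_1_iff z that E_sym by (metis Suc_1 Suc_eq_plus1)
    ultimately show ?thesis
      using d_0_iff by (auto simp: fibre_def)
  qed
  then have "{z. E x z \<and> fibre z y} = {z}"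
    using z by blast
  then show ?thesis
    using False by simp
qed

section \<open>Products of the distance matrices\<close>

abbreviation A where "A \<equiv> distance_matrix E"
abbreviation B :: "complex^'n^'n" where "B \<equiv> adjacency_matrix E"
abbreviation F :: "complex^'n^'n" where "F \<equiv> adjacency_matrix fibre"

text \<open>The intersection number usually written \<open>c_2\<close>.\<close>

definition c where "c = (SOME c. c > 0 \<and> (\<forall>x y. d x y = 2 \<longrightarrow> card {z. E x z \<and> E z y} = c))"

lemma c_pos: "c > 0"
  and card_c: "d x y = 2 \<Longrightarrow> card {z. E x z \<and> E z y} = c"
proof -
  have "c > 0 \<and> (\<forall>x y. d x y = 2 \<longrightarrow> card {z. E x z \<and> E z y} = c)"
    unfolding c_def by (rule someI_ex) (rule card_neighbours_2)
  then show "c > 0" "d x y = 2 \<Longrightarrow> card {z. E x z \<and> E z y} = c"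
    by blast+
qed

lemma A1_eq: "A 1 = B"
  by (rule distance_matrix_1[OF conn simple])

lemma F_eq: "mat 1 + A 3 = F"
  using d_0_iff by (auto simp: vec_eq_iff mat_def distance_matrix_def adjacency_matrix_def fibre_def)

lemma all_ones_eq: "all_ones = adjacency_matrix (\<lambda>_ _. True)"
  by (simp add: all_ones_def adjacency_matrix_def)

lemma degree: "card {y. E x y} = k" "card {y. E y x} = k"
  using edge_reg E_sym[of _ x] by (auto simp: edge_regular_def)

text \<open>Distance 3 occurs, so some class has two distinct members.\<close>

lemma a_ge_2: "a \<ge> 2"
proof -
  obtain x y where "d x y = 3"
    using ex_dist_3 by blast
  then have "{x, y} \<subseteq> {z. fibre x z}" "x \<noteq> y"
    by (auto simp: fibre_def)
  then show ?thesis
    using card_mono[of "{z. fibre x z}" "{x, y}"] card_fibre by simp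
qed

lemma k_pos: "k > 0"
proof -
  obtain x w where "E x w"
    using ex_path by blast
  then show ?thesis
    using degree(1)[of x] by (metis card_gt_0_iff empty_iff finite mem_Collect_eq)
qed

text \<open>The entries count common neighbours. At distance 3 there are none, since one would give
  a path of length 2.\<close>

lemma A1_A1: "(B ** B) $ x $ y =
  (if d x y = 0 then of_nat k else if d x y = 1 then of_nat lam else if d x y = 2 then of_nat c else 0)"
proof (cases x y rule: dist_cases)
  case 1
  then show ?thesis
    using degree(1)[of x] E_sym[of _ x] by (simp add: adjacency_matrix_mult)
next
  case 2
  then have "card {z. E x z \<and> E z y} = lam"
    using edge_reg E_sym[of _ y] by (simp add: edge_regular_def)
  then show ?thesis
    using 2 by (simp add: adjacency_matrix_mult)
next
  case 3
  then show ?thesis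
    by (simp add: adjacency_matrix_mult card_c)
next
  case 4
  have "\<not> (E x z \<and> E z y)" for z
    using 4 d_step[of x z y] d_1_iff[of z y] by auto
  then show ?thesis
    using 4 by (simp add: adjacency_matrix_mult)
qed

lemma card_fibre_neighbour: "card {z. fibre x z \<and> E z y} = (if fibre x y then 0 else 1)"
proof -
  have "fibre x z \<and> E z y \<longleftrightarrow> E y z \<and> fibre z x" for z
    using fibre_sym[of x z] E_sym[of z y] by auto
  then show ?thesis
    using card_neighbour_fibre[of y x] fibre_sym[of y x] by presburger
qed

lemma card_fibre_converse: "card {y. fibre y x} = a"
proof -
  have "{y. fibre y x} = {y. fibre x y}"
    by (rule Collect_cong) (rule fibre_sym)
  then show ?thesis
    using card_fibre by simp
qed

lemma products:
  "B ** F = all_ones - F"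
  "F ** B = all_ones - F"
  "F ** F = cmat_scale (of_nat a) F"
  "B ** all_ones = cmat_scale (of_nat k) all_ones"
  "all_ones ** B = cmat_scale (of_nat k) all_ones"
  "F ** all_ones = cmat_scale (of_nat a) all_ones"
  "all_ones ** F = cmat_scale (of_nat a) all_ones"
proof -
  have [simp]: "adjacency_matrix R $ x $ y = of_bool (R x y)" for R and x y :: 'n
    by (simp add: adjacency_matrix_def)
  note s = all_ones_eq vec_eq_iff adjacency_matrix_mult cmat_scale_def
    card_neighbour_fibre card_fibre_neighbour card_fibre_fibre card_fibre card_fibre_converse degree
  show "B ** F = all_ones - F"
    by (simp add: s)
  show "F ** B = all_ones - F"
    by (simp add: s)
  show "F ** F = cmat_scale (of_nat a) F"
    by (simp add: s)
  show "B ** all_ones = cmat_scale (of_nat k) all_ones"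
    by (simp add: s)
  show "all_ones ** B = cmat_scale (of_nat k) all_ones"
    by (simp add: s)
  show "F ** all_ones = cmat_scale (of_nat a) all_ones"
    by (simp add: s)
  show "all_ones ** F = cmat_scale (of_nat a) all_ones"
    by (simp add: s)
qed

lemma A3_eq: "A 3 = F - mat 1"
  by (simp flip: F_eq)

lemma A2_eq: "A 2 = all_ones - F - B"
proof -
  have "A 2 $ x $ y = (all_ones - F - B) $ x $ y" for x y
    by (cases x y rule: dist_cases)
      (auto simp: distance_matrix_def adjacency_matrix_def fibre_def all_ones_def mat_def simp flip: d_0_iff d_1_iff)
  then show ?thesis
    by (simp add: vec_eq_iff)
qed

section \<open>The six colours and their matrices\<close>

text \<open>Colours up to \<open>3\<close> are distances inside one copy of the graph; \<open>4\<close> and \<open>5\<close> are taken by pairs in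
  different copies.\<close>

definition colour :: "'t::finite \<times> 'n \<Rightarrow> 't \<times> 'n \<Rightarrow> nat" where
  "colour p q = (if fst p = fst q then d (snd p) (snd q) else if fibre (snd p) (snd q) then 4 else 5)"

abbreviation cm :: "nat \<Rightarrow> complex^('t::finite \<times> 'n)^('t \<times> 'n)" where
  "cm i \<equiv> adjacency_matrix (\<lambda>p q. colour p q = i)"

lemma d_neq [simp]: "d x y \<noteq> 4" "d x y \<noteq> 5"
  using d_le_3[of x y] by auto

lemma colour_less_6: "colour p q < 6"
  using d_le_3[of "snd p" "snd q"] by (simp add: colour_def)

lemma colour_sym: "colour p q = colour q p"
  by (simp add: colour_def d_sym[of "snd p"] fibre_sym[of "snd p"])

lemma colour_0_iff: "colour p q = 0 \<longleftrightarrow> p = q"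
  using d_0_iff by (auto simp: colour_def prod_eq_iff)

lemma colour_matrices:
  "mat 1 = cm 0"
  "kronecker (mat 1) (A 1) = cm 1"
  "kronecker (mat 1) (A 2) = cm 2"
  "kronecker (mat 1) (A 3) = cm 3"
  "kronecker (all_ones - mat 1) (mat 1 + A 3) = cm 4"
  "kronecker (all_ones - mat 1) (A 1 + A 2) = cm 5"
proof -
  show "mat 1 = cm 0"
    by (simp add: vec_eq_iff mat_def adjacency_matrix_def colour_0_iff)
  show "kronecker (mat 1) (A 1) = cm 1" "kronecker (mat 1) (A 2) = cm 2"
    "kronecker (mat 1) (A 3) = cm 3"
    by (auto simp: vec_eq_iff kronecker_def mat_def adjacency_matrix_def distance_matrix_def colour_def)
  have "A 1 + A 2 = all_ones - F"
    by (simp add: A1_eq A2_eq del: One_nat_def)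
  then show "kronecker (all_ones - mat 1) (mat 1 + A 3) = cm 4"
    "kronecker (all_ones - mat 1) (A 1 + A 2) = cm 5"
    unfolding F_eq by (auto simp: vec_eq_iff kronecker_def mat_def adjacency_matrix_def all_ones_def colour_def)
qed

lemma colour_algebra_eq: "colour_algebra colour = cmat.span {cm 0, cm 1, cm 2, cm 3, cm 4, cm 5}"
proof -
  have "{..<6::nat} = {0, 1, 2, 3, 4, 5}"
    by auto
  then show ?thesis
    using colour_algebra_eq_span[of colour 6, OF colour_less_6] by simp
qed

section \<open>A generating set adapted to multiplication\<close>

definition gens :: "(complex^('t::finite \<times> 'n)^('t \<times> 'n)) set" where
  "gens = {kronecker (mat 1) (mat 1), kronecker (mat 1) B, kronecker (mat 1) F,
    kronecker (mat 1) all_ones, kronecker all_ones F, kronecker all_ones all_ones}"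

lemma gens_cases:
  assumes "X \<in> gens"
  obtains "X = kronecker (mat 1) (mat 1)" | "X = kronecker (mat 1) B" | "X = kronecker (mat 1) F"
    | "X = kronecker (mat 1) all_ones" | "X = kronecker all_ones F" | "X = kronecker all_ones all_ones"
  using assms unfolding gens_def by blast

lemma kronecker_mat_1_mem:
  assumes "X \<in> colour_algebra d"
  shows "kronecker (mat 1) X \<in> colour_algebra colour"
proof -
  obtain g where "\<forall>x y. X $ x $ y = g (d x y)"
    using assms by (auto simp: colour_algebra_def)
  then show ?thesis
    \<comment> \<open>Colours above 3 belong to pairs in different copies, where the Kronecker
      product with the identity vanishes.\<close>
    by (intro colour_algebraI[where g = "\<lambda>i. if i \<le> 3 then g i else 0"])
      (simp add: kronecker_def mat_def colour_def d_le_3)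
qed

lemma gens_subset: "gens \<subseteq> colour_algebra colour"
proof -
  have "mat 1 \<in> colour_algebra d"
    by (rule colour_algebraI[where g = "\<lambda>i. of_bool (i = 0)"]) (simp add: mat_def d_0_iff)
  moreover have "B \<in> colour_algebra d"
    by (rule colour_algebraI[where g = "\<lambda>i. of_bool (i = 1)"])
      (simp add: adjacency_matrix_def d_1_iff del: One_nat_def)
  moreover have "F \<in> colour_algebra d"
    by (rule colour_algebraI[where g = "\<lambda>i. of_bool (i = 0 \<or> i = 3)"])
      (simp add: adjacency_matrix_def fibre_def)
  moreover have "all_ones \<in> colour_algebra d"
    by (rule colour_algebraI[where g = "\<lambda>_. 1"]) (simp add: all_ones_def)
  moreover have "kronecker all_ones F \<in> colour_algebra colour"
    by (rule colour_algebraI[where g = "\<lambda>i. of_bool (i \<in> {0, 3, 4})"])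
      (auto simp: kronecker_def colour_def all_ones_def adjacency_matrix_def fibre_def)
  moreover have "kronecker all_ones all_ones \<in> colour_algebra colour"
    by (rule colour_algebraI[where g = "\<lambda>_. 1"]) (simp add: kronecker_def all_ones_def)
  ultimately show ?thesis
    by (simp add: gens_def kronecker_mat_1_mem)
qed

text \<open>A change of spanning set: \<open>A 2\<close> and \<open>A 3\<close> are linear
  combinations of the identity, \<open>B\<close>, \<open>F\<close> and the all-ones matrix, so each
  colour matrix is a combination of generators.\<close>

lemma colour_algebra_eq_gens:
  "colour_algebra (colour :: 't::finite \<times> 'n \<Rightarrow> _) = cmat.span gens"
proof
  show "cmat.span gens \<subseteq> colour_algebra (colour :: 't \<times> 'n \<Rightarrow> _)"
    by (rule cmat.span_minimal[OF gens_subset subspace_colour_algebra])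
  have "gens \<subseteq> cmat.span (gens :: (complex^('t \<times> 'n)^('t \<times> 'n)) set)"
    by (rule cmat.span_superset)
  \<comment> \<open>Unfolding splits the inclusion into one membership fact per generator; folding
    restores \<open>gens\<close> inside the spans.\<close>
  note g = this[unfolded gens_def insert_subset, folded gens_def]
  have "A 1 + A 2 = all_ones - F"
    by (simp add: A1_eq A2_eq del: One_nat_def)
  then have "{cm 0, cm 1, cm 2, cm 3, cm 4, cm 5} \<subseteq> cmat.span (gens :: (complex^('t \<times> 'n)^('t \<times> 'n)) set)"
    using g unfolding colour_matrices[symmetric]
    by (simp add: F_eq A1_eq A2_eq A3_eq kronecker_diff cmat.span_diff kronecker_one_one del: One_nat_def)
  then show "colour_algebra (colour :: 't \<times> 'n \<Rightarrow> _) \<subseteq> cmat.span gens"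
    unfolding colour_algebra_eq by (rule cmat.span_minimal) (rule cmat.subspace_span)
qed

text \<open>Only closure under multiplication needs the structure of the graph. The rest holds
  because the matrices are constant on the classes of a symmetric colouring that singles out the
  diagonal.\<close>

lemma coherent_colour_algebra:
  "coherent_algebra (colour_algebra (colour :: 't::finite \<times> 'n \<Rightarrow> _))"
proof -
  have "B ** B \<in> colour_algebra d"
    by (rule colour_algebraI[OF A1_A1])
  then have AA: "kronecker (mat 1) (B ** B) \<in> cmat.span (gens :: (complex^('t \<times> 'n)^('t \<times> 'n)) set)"
    unfolding colour_algebra_eq_gens[symmetric] by (rule kronecker_mat_1_mem)
  have "gens \<subseteq> cmat.span (gens :: (complex^('t \<times> 'n)^('t \<times> 'n)) set)"
    by (rule cmat.span_superset)
  note g = this[unfolded gens_def insert_subset, folded gens_def]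
  have "X ** Y \<in> cmat.span gens" if "X \<in> gens" "Y \<in> gens" for X Y :: "complex^('t \<times> 'n)^('t \<times> 'n)"
    \<comment> \<open>Of the 36 products, all but the one involving \<open>B ** B\<close> follow
      from \<open>products\<close> and \<open>all_ones_all_ones\<close>; that one is
      \<open>AA\<close>.\<close>
    by (rule gens_cases[OF that(1)]; rule gens_cases[OF that(2)])
      (simp_all add: kronecker_mult products all_ones_all_ones kronecker_diff kronecker_scale
        cmat.span_diff cmat.span_scale AA g)
  then have mult: "X ** Y \<in> colour_algebra colour"
    if "X \<in> colour_algebra colour" "Y \<in> colour_algebra colour" for X Y :: "complex^('t \<times> 'n)^('t \<times> 'n)"
    using that span_matrix_mult[of gens X Y] unfolding colour_algebra_eq_gens by simp
  show ?thesis
    unfolding coherent_algebra_def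
  proof (intro conjI ballI)
    show "mat 1 \<in> colour_algebra (colour :: 't \<times> 'n \<Rightarrow> _)"
      unfolding colour_matrices(1) by (simp add: colour_algebra_eq cmat.span_base)
    show "all_ones \<in> colour_algebra (colour :: 't \<times> 'n \<Rightarrow> _)"
      by (rule colour_algebraI[where g = "\<lambda>_. 1"]) (simp add: all_ones_def)
  qed (simp_all add: subspace_colour_algebra mult hadamard_colour_algebra
      transpose_colour_algebra[OF colour_sym])
qed

section \<open>Separating the colours inside a coherent algebra\<close>

lemma K_matrix_eq: "(K_matrix E :: complex^('t::finite \<times> 'n)^('t \<times> 'n)) = cm 1 + cm 3 + cm 4"
  unfolding K_matrix_def colour_matrices(5) by (simp only: kronecker_add colour_matrices)

lemma K_matrix_mem: "K_matrix E \<in> colour_algebra colour"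
  unfolding K_matrix_eq colour_algebra_eq by (intro cmat.span_add cmat.span_base) auto

lemma A2_A2: "A 2 ** A 2 = cmat_scale (of_nat CARD('n) - 2 * of_nat a - 2 * of_nat k + 2) all_ones
    + cmat_scale (of_nat a - 2) F + B ** B"
  by (simp add: A2_eq matrix_diff_distrib products all_ones_all_ones)
    (simp add: vec_eq_iff cmat_scale_def all_ones_def algebra_simps)

lemma A2_A3: "A 2 ** A 3 = cmat_scale (of_nat a) (all_ones - F) - (all_ones - F) - A 2"
  by (simp add: A2_eq A3_eq matrix_diff_distrib products)
    (simp add: vec_eq_iff cmat_scale_def all_ones_def algebra_simps)

lemma A1_A2: "A 1 ** A 2 = cmat_scale (of_nat k) all_ones - (all_ones - F) - B ** B"
  by (simp add: A1_eq A2_eq matrix_diff_distrib products del: One_nat_def)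

lemma K_matrix_kronecker:
  "(K_matrix E :: complex^('t::finite \<times> 'n)^('t \<times> 'n))
    = kronecker (mat 1) B + kronecker all_ones F - mat 1"
  unfolding K_matrix_def F_eq
  by (simp add: A1_eq A3_eq kronecker_add kronecker_diff kronecker_one_one del: One_nat_def)

text \<open>The mask \<open>cm 2 + cm 5\<close> marks the distinct nonadjacent pairs. There the two
  cross terms contribute 1 each, \<open>B ** B\<close> adds \<open>c\<close> on colour 2 only, and
  all other terms vanish.\<close>

lemma K_matrix_square:
  "hadamard (K_matrix E ** K_matrix E :: complex^('t::finite \<times> 'n)^('t \<times> 'n)) (cm 2 + cm 5)
    = cmat_scale (of_nat c + 2) (cm 2) + cmat_scale 2 (cm 5)"
proof -
  have square: "K_matrix E ** K_matrix E =
      kronecker (mat 1) (B ** B) + kronecker all_ones (all_ones - F) - kronecker (mat 1) B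
      + (kronecker all_ones (all_ones - F)
         + cmat_scale (of_nat CARD('t)) (cmat_scale (of_nat a) (kronecker all_ones F)) - kronecker all_ones F)
      - (K_matrix E :: complex^('t \<times> 'n)^('t \<times> 'n))"
    unfolding K_matrix_kronecker
    by (simp add: matrix_diff_distrib matrix_add_ldistrib matrix_add_distrib_right kronecker_mult
        products all_ones_all_ones kronecker_scale kronecker_diff)
  show ?thesis
    unfolding square
    unfolding K_matrix_eq
    by (auto simp: vec_eq_iff hadamard_def adjacency_matrix_nth cmat_scale_def kronecker_def mat_def
        A1_A1 all_ones_def colour_def fibre_def d_1_iff[symmetric])
qed

text \<open>In \<open>A2_A2\<close> the all-ones term contributes equally to both colours;
  \<open>B ** B\<close> adds \<open>lam\<close> at distance 1 and \<open>F\<close> adds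
  \<open>a - 2\<close> at distance 3. Colour 4 drops out because \<open>cm 2\<close> is block
  diagonal.\<close>

lemma cm_2_square: "hadamard (cm 2 ** cm 2) (K_matrix E) =
   cmat_scale (of_nat CARD('n) - 2 * of_nat a - 2 * of_nat k + 2 + of_nat lam) (cm 1) +
   cmat_scale (of_nat CARD('n) - 2 * of_nat a - 2 * of_nat k + of_nat a) (cm 3)"
  unfolding colour_matrices[symmetric] kronecker_mult matrix_mul_lid A2_A2
  unfolding K_matrix_eq
  by (auto simp: vec_eq_iff hadamard_def adjacency_matrix_nth cmat_scale_def kronecker_def mat_def
     distance_matrix_def A1_A1 all_ones_def colour_def fibre_def)

text \<open>If \<open>x\<close> and \<open>y\<close> are at distance 3, all \<open>k\<close>
  neighbours of \<open>x\<close> are at distance 2 from \<open>y\<close>.\<close>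

lemma cm_1_cm_2: "hadamard (cm 1 ** cm 2) (cm 3 + cm 4) = cmat_scale (of_nat k) (cm 3)"
  unfolding colour_matrices(2,3)[symmetric] kronecker_mult matrix_mul_lid A1_A2
  by (auto simp: vec_eq_iff hadamard_def adjacency_matrix_nth cmat_scale_def kronecker_def mat_def
     A1_A1 all_ones_def colour_def fibre_def)

text \<open>For an edge from \<open>x\<close> to \<open>y\<close>, the \<open>a - 1\<close> other
  members of the class of \<open>y\<close> are all at distance 2 from \<open>x\<close>. At distance
  3 the count is zero, as distance 2 does not occur within a class.\<close>

lemma cm_2_cm_3: "hadamard (cm 2 ** cm 3) (K_matrix E) = cmat_scale (of_nat a - 1) (cm 1)"
  unfolding colour_matrices(3,4)[symmetric] kronecker_mult matrix_mul_lid A2_A3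
  unfolding K_matrix_eq
  by (auto simp: vec_eq_iff hadamard_def adjacency_matrix_nth cmat_scale_def kronecker_def mat_def
     distance_matrix_def all_ones_def colour_def fibre_def)

text \<open>The supports are disjoint, so the mixed terms vanish.\<close>

lemma hadamard_cm_1_3:
  "hadamard (cmat_scale s (cm 1) + cmat_scale u (cm 3)) (cmat_scale s (cm 1) + cmat_scale u (cm 3))
    = cmat_scale (s * s) (cm 1) + cmat_scale (u * u) (cm 3)"
  by (auto simp: vec_eq_iff hadamard_def adjacency_matrix_nth cmat_scale_def)

lemma all_ones_cm: "all_ones = cm 0 + K_matrix E + cm 2 + (cm 5 :: complex^('t::finite \<times> 'n)^('t \<times> 'n))"
proof -
  have "all_ones $ p $ q = (cm 0 + (cm 1 + cm 3 + cm 4) + cm 2 + cm 5) $ p $ q" for p q :: "'t \<times> 'n"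
  proof -
    have "colour p q \<in> {0, 1, 2, 3, 4, 5}"
      using colour_less_6[of p q] by auto
    then show ?thesis
      by (auto simp: all_ones_def adjacency_matrix_nth)
  qed
  then show ?thesis
    unfolding K_matrix_eq by (simp only: vec_eq_iff) blast
qed

lemma colour_matrices_mem:
  fixes W :: "(complex^('t::finite \<times> 'n)^('t \<times> 'n)) set"
  assumes W: "coherent_algebra W" and K: "K_matrix E \<in> W" and lam: "a \<noteq> lam + 2"
  shows "{cm 0, cm 1, cm 2, cm 3, cm 4, cm 5} \<subseteq> W"
proof -
  have sub: "cmat.subspace W" and mult: "\<And>X Y. X \<in> W \<Longrightarrow> Y \<in> W \<Longrightarrow> X ** Y \<in> W"
    and had: "\<And>X Y. X \<in> W \<Longrightarrow> Y \<in> W \<Longrightarrow> hadamard X Y \<in> W"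
    and one: "cm 0 \<in> W" and ones: "all_ones \<in> W"
    using W by (auto simp: coherent_algebra_def colour_matrices(1))
  note diff = cmat.subspace_diff[OF sub]
    and scale = cmat.subspace_scale[OF sub] and cancel = subspace_scale_cancel[OF sub]
  have N: "cm 2 + cm 5 \<in> W"
    using diff[OF diff[OF ones one] K] unfolding all_ones_cm by simp
  have "cmat_scale (of_nat c) (cm 2) \<in> W"
    using diff[OF had[OF mult[OF K K] N] scale[OF N, of 2]] unfolding K_matrix_square
    by (simp add: cmat.scale_right_distrib cmat.scale_left_distrib)
  then have cm2: "cm 2 \<in> W"
    using cancel c_pos by simp
  then have cm5: "cm 5 \<in> W"
    using diff[OF N cm2] by simp
  define s :: complex where "s = of_nat CARD('n) - 2 * of_nat a - 2 * of_nat k + 2 + of_nat lam"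
  define u :: complex where "u = of_nat CARD('n) - 2 * of_nat a - 2 * of_nat k + of_nat a"
  \<comment> \<open>The difference is \<open>lam + 2 - a\<close>; this is where the divisor being
    proper enters.\<close>
  have su: "s - u \<noteq> 0"
  proof
    assume "s - u = 0"
    then have "complex_of_nat (lam + 2) = of_nat a"
      by (simp add: s_def u_def algebra_simps)
    then show False
      using lam by (simp only: of_nat_eq_iff)
  qed
  define X :: "complex^('t \<times> 'n)^('t \<times> 'n)" where "X = cmat_scale s (cm 1) + cmat_scale u (cm 3)"
  have X: "X \<in> W"
    using had[OF mult[OF cm2 cm2] K] unfolding cm_2_square X_def s_def u_def .
  have XX: "hadamard X X = cmat_scale (s * s) (cm 1) + cmat_scale (u * u) (cm 3)"
    unfolding X_def by (rule hadamard_cm_1_3)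
  \<comment> \<open>Interpolation on the values \<open>s\<close> and \<open>u\<close> of
    \<open>X\<close>: subtracting \<open>u\<close> times \<open>X\<close> kills the coefficient on
    \<open>cm 3\<close>, and subtracting \<open>s\<close> times \<open>X\<close> the one on
    \<open>cm 1\<close>.\<close>
  have "hadamard X X - cmat_scale u X = cmat_scale (s * (s - u)) (cm 1)"
    "hadamard X X - cmat_scale s X = cmat_scale (u * (u - s)) (cm 3)"
    unfolding XX unfolding X_def by (simp_all add: vec_eq_iff cmat_scale_def algebra_simps)
  then have s: "cmat_scale (s * (s - u)) (cm 1) \<in> W" and u: "cmat_scale (u * (u - s)) (cm 3) \<in> W"
    using diff[OF had[OF X X] scale[OF X]] by metis+
  have "cm 1 \<in> W \<and> cm 3 \<in> W"
  \<comment> \<open>As \<open>s\<close> and \<open>u\<close> differ, \<open>s = 0\<close> forces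
    \<open>u\<close> to be nonzero; so one of \<open>cm 1\<close> and \<open>cm 3\<close> is always
    available.\<close>
  proof (cases "s = 0")
    case False
    then have cm1: "cm 1 \<in> W"
      using cancel[OF s] su by simp
    then have "cm 3 + cm 4 \<in> W"
      using diff[OF K cm1] unfolding K_matrix_eq by (simp add: add.assoc)
    then have "cmat_scale (of_nat k) (cm 3) \<in> W"
      using had[OF mult[OF cm1 cm2]] unfolding cm_1_cm_2[symmetric] by blast
    then show ?thesis
      using cm1 cancel k_pos by simp
  next
    case True
    then have cm3: "cm 3 \<in> W"
      using cancel[OF u] su by simp
    have "cmat_scale (of_nat a - 1) (cm 1) \<in> W"
      using had[OF mult[OF cm2 cm3] K] unfolding cm_2_cm_3 .
    moreover have "complex_of_nat a - 1 \<noteq> 0"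
      using a_ge_2 by auto
    ultimately show ?thesis
      using cm3 cancel by blast
  qed
  moreover have "(cm 4 :: complex^('t \<times> 'n)^('t \<times> 'n)) = K_matrix E - cm 1 - cm 3"
    unfolding K_matrix_eq by simp
  ultimately show ?thesis
    using one cm2 cm5 K diff by auto
qed

text \<open>One inclusion is minimality of the closure against the colour algebra; the other applies
  \<open>colour_matrices_mem\<close> to the closure itself.\<close>

lemma coherent_closure_K_graph:
  assumes "a \<noteq> lam + 2"
  shows "coherent_closure (K_graph E :: 't::finite \<times> 'n \<Rightarrow> _) =
    cmat.span {cm 0, cm 1, cm 2, cm 3, cm 4, cm 5}"
proof
  show "coherent_closure (K_graph E :: 't \<times> 'n \<Rightarrow> _) \<subseteq>
      cmat.span {cm 0, cm 1, cm 2, cm 3, cm 4, cm 5}"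
    unfolding colour_algebra_eq[symmetric]
    by (rule coherent_closure_is_least)
      (simp_all add: coherent_colour_algebra adjacency_matrix_K_graph K_matrix_mem)
  have W: "coherent_algebra (coherent_closure (K_graph E :: 't \<times> 'n \<Rightarrow> _))"
    "K_matrix E \<in> coherent_closure (K_graph E :: 't \<times> 'n \<Rightarrow> _)"
    using coherent_closure_is_least(1,2) adjacency_matrix_K_graph by metis+
  then show "cmat.span {cm 0, cm 1, cm 2, cm 3, cm 4, cm 5} \<subseteq>
      coherent_closure (K_graph E :: 't \<times> 'n \<Rightarrow> _)"
    using colour_matrices_mem[OF W assms] by (intro cmat.span_minimal) (auto simp: coherent_algebra_def)
qed

end

theorem theorem2p10:
  fixes E :: "'n::finite \<Rightarrow> 'n \<Rightarrow> bool"
    and K :: "'t::finite \<times> 'n \<Rightarrow> 't \<times> 'n \<Rightarrow> bool"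
    and A :: "nat \<Rightarrow> complex^'n^'n"
    and a v k lam :: nat
  assumes "simple_graph E"
    and "graph_diameter E = 3"
    and "antipodal a E"
    and "distance_regular E"
    and "edge_regular v k lam E"
    and "a dvd lam + 2" and "a \<noteq> lam + 2"
    and "CARD('t) = (lam + 2) div a"
    and "A = distance_matrix E"
    and "coherent_closure E = cmat.span {mat 1, A 1, A 2, A 3}"
    and "K = K_graph E"
  shows "coherent_closure K =
    cmat.span {mat 1,
      kronecker (mat 1) (A 1),
      kronecker (mat 1) (A 2),
      kronecker (mat 1) (A 3),
      kronecker (all_ones - mat 1) (mat 1 + A 3),
      kronecker (all_ones - mat 1) (A 1 + A 2)}"
proof -
  interpret antipodal_drg3 E a v k lam
    by unfold_locales (use assms in auto)
  show ?thesis
    using coherent_closure_K_graph[OF assms(7)]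
    unfolding \<open>A = _\<close> \<open>K = _\<close> colour_matrices .
qed

end
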